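(* Let $t\ge 1$ and let $m=p_{1}\cdots p_{t}$, where each of $p_{1},\dots,p_{t}$ is a prime or a prime power. Let $r,k$ be positive integers with $r<k\leq \min\{p_{1},\dots,p_{t}\}$, and let $U=(u_{i,j})$ be a $k\times k$ (complex) unitary matrix with largest absolute entry $\alpha=\max_{i,j}|u_{i,j}|$. Then there exists a complex matrix of size $mk\times (mk\cdot m^{r})$ which is a union of $m^{r}$ orthonormal bases of $\mathbb{C}^{mk}$, whose coherence is at most $\min(r\alpha^{2},1)$, and whose density is $\frac{1}{m}$.
   Context: A matrix is a union of $Q$ orthonormal bases of $\mathbb{C}^{n}$ if it is of size $n\times nQ$ and is the column-wise concatenation of $Q$ unitary $n\times n$ matrices. The coherence of a matrix $\Phi$ with nonzero columns $\phi_1,\dots,\phi_M$ is $\mu_\Phi=\max_{i\ne j}\frac{|\langle \phi_i,\phi_j\rangle|}{\|\phi_i\|_2\|\phi_j\|_2}$, with $\langle\cdot,\cdot\rangle$ the standard Hermitian inner product. The density of a matrix is the ratio of the number of its nonzero entries to the total number of its entries. *)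

theory Defs
  imports
    "HOL-Analysis.L2_Norm"
    "HOL-Number_Theory.Prime_Powers"
    "Jordan_Normal_Form.Schur_Decomposition"
begin

definition unitary_mat :: "complex mat \<Rightarrow> bool" where
  "unitary_mat A \<longleftrightarrow>
     square_mat A \<and> inverts_mat A (mat_adjoint A) \<and> inverts_mat (mat_adjoint A) A"

definition union_of_orthonormal_bases :: "nat \<Rightarrow> nat \<Rightarrow> complex mat \<Rightarrow> bool" where
  "union_of_orthonormal_bases n Q A \<longleftrightarrow>
     A \<in> carrier_mat n (n * Q) \<and>
     (\<exists>Us. length Us = Q \<and>
        (\<forall>V \<in> set Us. V \<in> carrier_mat n n \<and> unitary_mat V) \<and>
        A = mat_of_cols n (concat (map cols Us)))"

definition l2_norm_vec :: "complex vec \<Rightarrow> real" where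
  "l2_norm_vec v = L2_set (\<lambda>i. cmod (v $ i)) {..<dim_vec v}"

(* Only meaningful for a matrix with at least two columns, all of them nonzero:
   otherwise Max is taken over the empty set or a division by zero occurs. *)
definition coherence :: "complex mat \<Rightarrow> real" where
  "coherence A =
     Max {cmod (col A i \<bullet>c col A j) / (l2_norm_vec (col A i) * l2_norm_vec (col A j)) | i j.
            i < dim_col A \<and> j < dim_col A \<and> i \<noteq> j}"

definition density :: "complex mat \<Rightarrow> real" where
  "density A =
     real (card {(i, j). i < dim_row A \<and> j < dim_col A \<and> A $$ (i, j) \<noteq> 0})
       / real (dim_row A * dim_col A)"

end

theory Submission
  imports Defs
begin

text \<open>
  A unitary \<open>k \<times> k\<close> matrix has an entry of modulus at least \<open>1 / sqrt k\<close>, so \<open>U\<close> may be replaced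
  by the Fourier matrix: it attains this bound, and as it has no zero entry the density is exact.
  For a prime power \<open>q\<close>, polynomials of degree at most \<open>r\<close> over the field with \<open>q\<close> elements give
  \<open>q ^ (r + 1)\<close> words of length \<open>k\<close> any two of which agree in at most \<open>r\<close> places, and varying the
  constant term partitions the words into classes of disjoint graphs; products of such codes yield
  one over an alphabet of size \<open>m\<close>. Placing the Fourier vectors on the graphs turns every class
  into an orthonormal basis, and vectors of different bases overlap in at most \<open>r\<close> coordinates,
  each of which contributes \<open>1 / k\<close> to the inner product.

  The field with \<open>q = p ^ n\<close> elements is found as a set of residues of \<open>\<int>[X]\<close> modulo a prime ideal
  that contains all \<open>f\<close> with \<open>f(\<zeta>) \<in> p\<int>[\<zeta>]\<close>, \<open>\<zeta>\<close> a primitive \<open>(q - 1)\<close>-th root of unity in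
  \<open>\<complex>\<close>: zero and the powers of \<open>X\<close> are then the \<open>q\<close> distinct roots of \<open>Y ^ q - Y\<close>.
\<close>

section \<open>Prime ideals\<close>

text \<open>Congruence is written \<open>x - y \<in> P\<close> throughout instead of passing to a
  quotient ring, so the ideal laws are collected below in terms of differences.\<close>

locale proper_ideal =
  fixes P :: "'a::comm_ring_1 set"
  assumes zero_in [simp]: "0 \<in> P"
    and add_in: "x \<in> P \<Longrightarrow> y \<in> P \<Longrightarrow> x + y \<in> P"
    and mult_in: "x \<in> P \<Longrightarrow> a * x \<in> P"
    and one_notin: "1 \<notin> P"
begin

lemma minus_in: "x \<in> P \<Longrightarrow> - x \<in> P"
  using mult_in[of x "-1"] by simp

lemma diff_in: "x \<in> P \<Longrightarrow> y \<in> P \<Longrightarrow> x - y \<in> P"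
  using add_in[of x "-y"] minus_in by simp

lemma mult_in': "x \<in> P \<Longrightarrow> x * a \<in> P"
  using mult_in[of x a] by (simp add: mult.commute)

lemma sum_in: "(\<And>i. i \<in> I \<Longrightarrow> f i \<in> P) \<Longrightarrow> sum f I \<in> P"
  by (induction I rule: infinite_finite_induct) (auto intro: add_in)

lemma diff_swap: "x - y \<in> P \<Longrightarrow> y - x \<in> P"
  using minus_in[of "x - y"] by simp

lemma diff_trans: "x - y \<in> P \<Longrightarrow> y - z \<in> P \<Longrightarrow> x - z \<in> P"
  using add_in[of "x - y" "y - z"] by simp

lemma diff_add: "x - y \<in> P \<Longrightarrow> x' - y' \<in> P \<Longrightarrow> (x + x') - (y + y') \<in> P"
  using add_in[of "x - y" "x' - y'"] by (simp add: algebra_simps)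

lemma diff_power:
  assumes "x - y \<in> P"
  shows "x ^ n - y ^ n \<in> P"
  using mult_in'[OF assms] by (simp add: power_diff_sumr2)

end

locale prime_ideal = proper_ideal +
  assumes prime_in: "x * y \<in> P \<Longrightarrow> x \<in> P \<or> y \<in> P"

text \<open>Zorn's lemma yields an ideal \<open>M\<close> that is maximal among the proper ideals
  containing \<open>P\<close>, and maximal ideals are prime.\<close>

lemma (in proper_ideal) prime_ideal_above:
  obtains M where "prime_ideal M" "P \<subseteq> M"
proof -
  define \<A> where "\<A> = {I. proper_ideal I \<and> P \<subseteq> I}"
  have "P \<in> \<A>"
    by (simp add: \<A>_def proper_ideal_axioms)
  moreover have "\<Union>\<C> \<in> \<A>" if ne: "\<C> \<noteq> {}" and ch: "subset.chain \<A> \<C>" for \<C>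
  proof -
    have I: "proper_ideal I" "P \<subseteq> I" if "I \<in> \<C>" for I
      using ch that by (auto simp: subset.chain_def \<A>_def)
    have tot: "I \<subseteq> J \<or> J \<subseteq> I" if "I \<in> \<C>" "J \<in> \<C>" for I J
      using ch that by (auto simp: subset_chain_def)
    have "proper_ideal (\<Union>\<C>)"
    proof
      show "0 \<in> \<Union>\<C>"
        using ne I(1) proper_ideal.zero_in by blast
      show "x + y \<in> \<Union>\<C>" if "x \<in> \<Union>\<C>" "y \<in> \<Union>\<C>" for x y
      proof -
        from that obtain J1 J2 where J: "J1 \<in> \<C>" "J2 \<in> \<C>" "x \<in> J1" "y \<in> J2" by blast
        then obtain J where "J \<in> \<C>" "x \<in> J" "y \<in> J" using tot by blast
        then show ?thesis using proper_ideal.add_in[OF I(1)] by blast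
      qed
      show "a * x \<in> \<Union>\<C>" if "x \<in> \<Union>\<C>" for a x
        using that proper_ideal.mult_in[OF I(1)] by blast
      show "1 \<notin> \<Union>\<C>"
        using proper_ideal.one_notin[OF I(1)] by blast
    qed
    then show ?thesis
      using ne I(2) by (auto simp: \<A>_def)
  qed
  ultimately obtain M where M: "M \<in> \<A>" and max: "\<And>X. X \<in> \<A> \<Longrightarrow> M \<subseteq> X \<Longrightarrow> X = M"
    using subset_Zorn_nonempty[of \<A>] by blast
  interpret M: proper_ideal M
    using M by (simp add: \<A>_def)
  have "prime_ideal M"
  proof
    fix x y assume xy: "x * y \<in> M"
    show "x \<in> M \<or> y \<in> M"
    proof (rule ccontr)
      assume "\<not> (x \<in> M \<or> y \<in> M)"
      then have x: "x \<notin> M" and y: "y \<notin> M" by auto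
      \<comment> \<open>\<open>N\<close> is the ideal generated by \<open>M\<close> and
        \<open>x\<close>. Being strictly larger than \<open>M\<close>, it cannot be proper;
        multiplying \<open>1 = u + x * s\<close> by \<open>y\<close> then puts \<open>y\<close> into
        \<open>M\<close>.\<close>
      define N where "N = {u + x * s | u s. u \<in> M}"
      have sub: "M \<subseteq> N"
        unfolding N_def by (force intro: exI[of _ "0::'a"])
      have xN: "x \<in> N"
        unfolding N_def by (intro CollectI exI[of _ "0::'a"] exI[of _ "1::'a"]) simp
      have "1 \<in> N"
      proof (rule ccontr)
        assume 1: "1 \<notin> N"
        have "proper_ideal N"
        proof
          show "0 \<in> N" using sub by auto
          show "a + b \<in> N" if "a \<in> N" "b \<in> N" for a b
          proof -
            from that obtain u s u' s' where "a = u + x * s" "b = u' + x * s'" "u \<in> M" "u' \<in> M"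
              unfolding N_def by blast
            then have "a + b = (u + u') + x * (s + s')" "u + u' \<in> M"
              by (auto simp: algebra_simps M.add_in)
            then show ?thesis unfolding N_def by blast
          qed
          show "c * a \<in> N" if "a \<in> N" for c a
          proof -
            from that obtain u s where "a = u + x * s" "u \<in> M"
              unfolding N_def by blast
            then have "c * a = c * u + x * (c * s)" "c * u \<in> M"
              by (auto simp: algebra_simps M.mult_in)
            then show ?thesis unfolding N_def by blast
          qed
        qed (rule 1)
        then have "N \<in> \<A>" using sub M by (auto simp: \<A>_def)
        with max sub have "N = M" by blast
        with xN x show False by simp
      qed
      then obtain u s where us: "1 = u + x * s" "u \<in> M" unfolding N_def by blast
      have "y = (u + x * s) * y" using us(1) by simp
      also have "\<dots> = u * y + x * y * s" by (simp add: algebra_simps)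
      also have "\<dots> \<in> M" using us(2) xy by (simp add: M.add_in M.mult_in')
      finally show False using y by simp
    qed
  qed
  then show thesis
    using that M by (auto simp: \<A>_def)
qed

section \<open>Roots of polynomials and the Frobenius map modulo a prime ideal\<close>

context prime_ideal
begin

text \<open>This is the bound on the number of roots over an integral domain, read modulo
  \<open>P\<close>. It is used both to find all fixed points of the Frobenius map and to bound the
  agreement of code words.\<close>

lemma coeff_in_of_many_roots:
  assumes "degree f \<le> n" "finite S" "n < card S"
    and "\<And>s. s \<in> S \<Longrightarrow> poly f s \<in> P"
    and "\<And>s t. s \<in> S \<Longrightarrow> t \<in> S \<Longrightarrow> s \<noteq> t \<Longrightarrow> s - t \<notin> P"
  shows "coeff f i \<in> P"
  using assms
proof (induction n arbitrary: f S i)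
  case 0
  then obtain s where "s \<in> S" by fastforce
  moreover obtain c where "f = [:c:]" using 0(1) degree_eq_zeroE by blast
  ultimately show ?case using 0(4)[of s] by (cases i) auto
next
  case (Suc n)
  then obtain s where s: "s \<in> S" by fastforce
  \<comment> \<open>Dividing by \<open>X - s\<close> lowers the degree. The other points remain
    roots of the quotient modulo \<open>P\<close>, because \<open>t - s\<close> is outside
    \<open>P\<close> and can be cancelled.\<close>
  define g where "g = synthetic_div f s"
  have f: "f = [:-s, 1:] * g + [:poly f s:]"
    using synthetic_div_correct'[of s f] by (simp only: g_def)
  have g: "coeff g j \<in> P" for j
  proof (rule Suc.IH[of g "S - {s}"])
    show "degree g \<le> n" using Suc.prems(1) by (simp add: g_def degree_synthetic_div)
    show "finite (S - {s})" "n < card (S - {s})" using Suc.prems(2,3) s by auto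
    show "poly g t \<in> P" if "t \<in> S - {s}" for t
    proof -
      have "poly f t = (t - s) * poly g t + poly f s"
        by (subst f) (simp add: algebra_simps)
      then have "(t - s) * poly g t = poly f t - poly f s" by simp
      also have "\<dots> \<in> P" using Suc.prems(4) s that by (intro diff_in) auto
      finally show ?thesis using prime_in Suc.prems(5) s that by blast
    qed
    show "a - b \<notin> P" if "a \<in> S - {s}" "b \<in> S - {s}" "a \<noteq> b" for a b
      using Suc.prems(5) that by auto
  qed
  have "coeff f i = - (s * coeff g i) + (case i of 0 \<Rightarrow> poly f s | Suc j \<Rightarrow> coeff g j)"
    by (subst f) (simp add: coeff_pCons split: nat.split)
  also have "\<dots> \<in> P"
    using g Suc.prems(4)[OF s] by (intro add_in minus_in mult_in) (auto split: nat.split)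
  finally show ?case .
qed

text \<open>The inner binomial coefficients of a \<open>p\<close>-th power are multiples of
  \<open>p\<close>, hence vanish modulo \<open>P\<close>; iterating gives the exponent
  \<open>p ^ n\<close>.\<close>

lemma frobenius_add:
  assumes "prime p" "of_nat p \<in> P"
  shows "(x + y) ^ (p ^ n) - (x ^ (p ^ n) + y ^ (p ^ n)) \<in> P"
proof (induction n)
  case 0
  then show ?case by simp
next
  case (Suc n)
  have binom: "(a + b) ^ p - (a ^ p + b ^ p) \<in> P" for a b
  proof -
    have p0: "p > 0" using assms(1) prime_gt_0_nat by simp
    have "(a + b) ^ p = (\<Sum>k\<le>p. of_nat (p choose k) * a ^ k * b ^ (p - k))"
      by (rule binomial_ring)
    also have "{..p} = insert 0 (insert p {0<..<p})" using p0 by auto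
    also have "(\<Sum>k\<in>\<dots>. of_nat (p choose k) * a ^ k * b ^ (p - k))
        = b ^ p + (a ^ p + (\<Sum>k\<in>{0<..<p}. of_nat (p choose k) * a ^ k * b ^ (p - k)))"
      using p0 by simp
    finally have "(a + b) ^ p - (a ^ p + b ^ p)
        = (\<Sum>k\<in>{0<..<p}. of_nat (p choose k) * a ^ k * b ^ (p - k))"
      by simp
    also have "\<dots> \<in> P"
    proof (rule sum_in)
      fix k assume k: "k \<in> {0<..<p}"
      then have "p dvd (p choose k)" using assms(1) p0 by (intro dvd_choose_prime) auto
      then obtain c where "p choose k = p * c" by (elim dvdE)
      then have "of_nat (p choose k) * a ^ k * b ^ (p - k)
          = of_nat p * (of_nat c * a ^ k * b ^ (p - k))"
        by (simp add: algebra_simps)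
      also have "\<dots> \<in> P" using assms(2) by (rule mult_in')
      finally show "of_nat (p choose k) * a ^ k * b ^ (p - k) \<in> P" .
    qed
    finally show ?thesis .
  qed
  have "((x + y) ^ (p ^ n)) ^ p - (x ^ (p ^ n) + y ^ (p ^ n)) ^ p \<in> P"
    using Suc by (rule diff_power)
  from diff_trans[OF this binom] show ?case
    by (simp add: power_mult[symmetric] mult.commute)
qed

text \<open>The residues fixed by the \<open>p ^ n\<close>-th power are closed under sums and
  products. Values of code polynomials therefore stay among the residues that \<open>T\<close> will
  represent.\<close>

lemma poly_frobenius_fixed:
  assumes p: "prime p" "of_nat p \<in> P"
    and x: "x ^ (p ^ n) - x \<in> P"
    and f: "\<And>i. coeff f i ^ (p ^ n) - coeff f i \<in> P"
  shows "poly f x ^ (p ^ n) - poly f x \<in> P"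
  using f
proof (induction f)
  case 0
  then show ?case using p(1) by (simp add: prime_gt_0_nat)
next
  case (pCons a f)
  have a: "a ^ (p ^ n) - a \<in> P"
    using pCons.prems[of 0] by simp
  have IH: "poly f x ^ (p ^ n) - poly f x \<in> P"
    by (rule pCons.IH) (use pCons.prems[of "Suc i" for i] in simp)
  have "(x * poly f x) ^ (p ^ n) - x * poly f x
      = x ^ (p ^ n) * (poly f x ^ (p ^ n) - poly f x) + (x ^ (p ^ n) - x) * poly f x"
    by (simp add: algebra_simps power_mult_distrib)
  also have "\<dots> \<in> P"
    using IH x by (intro add_in mult_in mult_in')
  finally have "(x * poly f x) ^ (p ^ n) - x * poly f x \<in> P" .
  with a have "a ^ (p ^ n) + (x * poly f x) ^ (p ^ n) - (a + x * poly f x) \<in> P"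
    by (rule diff_add)
  from diff_trans[OF frobenius_add[OF p] this] show ?case by simp
qed

end

section \<open>Prime ideals with prescribed finite residue field\<close>

text \<open>The vector \<open>v\<close> is a nonzero eigenvector of the integer matrix
  \<open>a\<close> for the eigenvalue \<open>x\<close>, so \<open>x\<close> is a root of a monic
  integer polynomial, the characteristic one.\<close>

lemma algebraic_int_of_stable_lattice:
  fixes x :: complex and v :: "nat \<Rightarrow> complex" and a :: "nat \<Rightarrow> nat \<Rightarrow> int"
  assumes v: "i0 < n" "v i0 \<noteq> 0"
    and stable: "\<And>i. i < n \<Longrightarrow> x * v i = (\<Sum>j<n. of_int (a i j) * v j)"
  shows "algebraic_int x"
proof -
  define B where "B = mat n n (\<lambda>(i, j). a i j)"
  define C :: "complex mat" where "C = map_mat of_int B"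
  have B: "B \<in> carrier_mat n n" and C: "C \<in> carrier_mat n n" by (auto simp: B_def C_def)
  have "vec n v \<noteq> 0\<^sub>v n" using v by (metis index_vec index_zero_vec(1))
  moreover have "C *\<^sub>v vec n v = x \<cdot>\<^sub>v vec n v"
    by (rule eq_vecI)
      (auto simp: C_def B_def scalar_prod_def stable atLeast0LessThan)
  ultimately have "eigenvalue C x"
    using C unfolding eigenvalue_def eigenvector_def by (intro exI[of _ "vec n v"]) auto
  then have "poly (char_poly C) x = 0" using eigenvalue_root_char_poly[OF C] by simp
  moreover have "char_poly C = map_poly of_int (char_poly B)"
    unfolding C_def by (rule of_int_hom.char_poly_hom[OF B])
  moreover have "lead_coeff (char_poly B) = 1"
    using degree_monic_char_poly[OF B] by auto
  ultimately show ?thesis unfolding algebraic_int_altdef_ipoly by metis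
qed

lemma root_of_unity_combination:
  fixes z :: complex
  assumes "z ^ N = 1" "N > 0"
  shows "\<exists>c. poly (of_int_poly f) z = (\<Sum>j<N. of_int (c j) * z ^ j)"
proof (induction f)
  case 0
  show ?case by (intro exI[of _ "\<lambda>_. 0"]) simp
next
  case (pCons a f)
  then obtain c where c: "poly (of_int_poly f) z = (\<Sum>j<N. of_int (c j) * z ^ j)" by blast
  obtain M where N: "N = Suc M" using assms(2) gr0_implies_Suc by blast
  \<comment> \<open>Multiplication by \<open>z\<close> shifts the coefficients by one place; the
    last one, \<open>c M\<close>, wraps around to place 0 since \<open>z ^ N = 1\<close>.\<close>
  define d where "d = (\<lambda>j. case j of 0 \<Rightarrow> a + c M | Suc i \<Rightarrow> c i)"
  have "(\<Sum>j<N. of_int (d j) * z ^ j) = of_int a + of_int (c M) * z ^ N + (\<Sum>j<M. of_int (c j) * z ^ Suc j)"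
    using assms(1) unfolding N sum.lessThan_Suc_shift by (simp add: d_def)
  also have "\<dots> = of_int a + z * (\<Sum>j<N. of_int (c j) * z ^ j)"
    unfolding N by (simp add: sum_distrib_left algebra_simps)
  finally have "(\<Sum>j<N. of_int (d j) * z ^ j) = poly (of_int_poly (pCons a f)) z"
    using c by (simp add: of_int_hom.map_poly_pCons_hom)
  then show ?case by metis
qed

text \<open>Otherwise \<open>1 / p\<close> would be the value of an integer polynomial at
  \<open>z\<close>, hence would map the lattice spanned by the powers of \<open>z\<close> to itself
  and be an algebraic integer. A rational algebraic integer is an integer, which is impossible for
  \<open>p > 1\<close>. This makes the ideal \<open>J\<close> of the next proof proper.\<close>

lemma no_inverse_mod_in_cyclotomic_ring:
  fixes z :: complex and g :: "int poly"
  assumes "z ^ N = 1" "N > 0" "p > 1"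
  shows "of_nat p * poly (of_int_poly g) z \<noteq> 1"
proof
  assume 1: "of_nat p * poly (of_int_poly g) z = 1"
  define x where "x = poly (of_int_poly g) z"
  have "\<exists>c. x * z ^ i = (\<Sum>j<N. of_int (c j) * z ^ j)" for i
    using root_of_unity_combination[OF assms(1,2), of "g * monom 1 i"]
    by (simp add: x_def of_int_poly_hom.hom_mult map_poly_monom poly_monom)
  then obtain a where a: "\<And>i. x * z ^ i = (\<Sum>j<N. of_int (a i j) * z ^ j)"
    by metis
  have "algebraic_int x"
    by (rule algebraic_int_of_stable_lattice[of 0 N "\<lambda>j. z ^ j" _ a]) (use assms a in auto)
  moreover have x: "x = 1 / of_nat p"
    using 1 assms(3) by (simp add: x_def field_simps)
  moreover have "x \<in> \<rat>" by (simp add: x)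
  ultimately have "x \<in> \<int>" using rational_algebraic_int_is_int by blast
  then obtain k where "x = of_int k" by (elim Ints_cases)
  then have "of_int (int p * k) = (1 :: complex)" using 1 by (simp add: x_def)
  then have "int p * k = 1" using of_int_eq_1_iff by blast
  then show False using assms(3) by (auto simp: zmult_eq_1_iff)
qed

lemma exists_prime_ideal_with_residue_field:
  assumes p: "prime p" and n: "n > 0"
  obtains P :: "int poly set" and T where
    "prime_ideal P" "of_nat p \<in> P" "finite T" "card T = p ^ n"
    "\<And>s t. s \<in> T \<Longrightarrow> t \<in> T \<Longrightarrow> s \<noteq> t \<Longrightarrow> s - t \<notin> P"
    "\<And>t. t \<in> T \<Longrightarrow> t ^ (p ^ n) - t \<in> P"
proof -
  define N where "N = p ^ n - 1"
  have p1: "p > 1" using p prime_gt_1_nat by simp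
  have pn: "p ^ n > 1" using one_less_power[OF p1 n] .
  then have N: "N > 0" and q: "p ^ n = Suc N" by (auto simp: N_def)
  define z where "z = cis (2 * pi / N)"
  have zN: "z ^ N = 1" using N by (simp add: z_def DeMoivre)
  have zd: "z ^ d \<noteq> 1" if "0 < d" "d < N" for d
  proof
    assume "z ^ d = 1"
    then have eq: "cis (2 * pi * d / N) = cis (2 * pi * 0 / N)"
      by (simp add: z_def DeMoivre mult.commute)
    have inj: "inj_on (\<lambda>k. cis (2 * pi * real k / real N)) {..<N}"
      using bij_betw_roots_unity[OF N] by (simp add: bij_betw_def)
    show False using inj_onD[OF inj, of d 0] eq that by simp
  qed
  define ev where "ev = (\<lambda>f. poly (of_int_poly f) z)"
  have ev_simps: "ev (f + g) = ev f + ev g" "ev (f * g) = ev f * ev g" "ev 0 = 0" "ev 1 = 1"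
    "ev (f ^ k) = ev f ^ k" for f g k
    by (auto simp: ev_def of_int_poly_hom.hom_add of_int_poly_hom.hom_mult of_int_poly_hom.hom_power)
  have ev_nat: "ev (of_nat k) = of_nat k" for k
    by (induction k) (auto simp: ev_simps)
  define J where "J = {f. \<exists>g. ev f = of_nat p * ev g}"
  interpret J: proper_ideal J
  proof
    show "0 \<in> J" unfolding J_def by (auto intro!: exI[of _ 0] simp: ev_simps)
    show "f + g \<in> J" if "f \<in> J" "g \<in> J" for f g
      using that unfolding J_def by (auto simp: ev_simps distrib_left[symmetric])
        (metis ev_simps(1))
    show "a * f \<in> J" if "f \<in> J" for a f
    proof -
      from that obtain g where "ev f = of_nat p * ev g" by (auto simp: J_def)
      then have "ev (a * f) = of_nat p * ev (a * g)" by (simp add: ev_simps)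
      then show ?thesis unfolding J_def by blast
    qed
    have "1 \<noteq> of_nat p * ev g" for g
      unfolding ev_def using no_inverse_mod_in_cyclotomic_ring[OF zN N p1] by metis
    then show "1 \<notin> J"
      by (simp add: J_def ev_simps)
  qed
  obtain P where P: "prime_ideal P" and JP: "J \<subseteq> P" by (rule J.prime_ideal_above)
  interpret prime_ideal P by (rule P)
  define X :: "int poly" where "X = [:0, 1:]"
  have evX: "ev X = z" by (simp add: ev_def X_def)
  have ker: "f \<in> P" if "ev f = 0" for f
    using that JP by (auto simp: J_def intro!: subsetD[OF JP] exI[of _ 0] simp: ev_simps)
  have pP: "of_nat p \<in> P"
    by (rule subsetD[OF JP]) (auto simp: J_def ev_simps ev_nat intro: exI[of _ 1])
  have ev_diff: "ev (f - 1) = ev f - 1" for f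
    using ev_simps(1)[of "f - 1" 1] ev_simps(4) by simp
  have XN: "X ^ N - 1 \<in> P"
    by (rule ker) (simp add: ev_diff ev_simps evX zN)
  have XP: "X \<notin> P"
  proof
    assume "X \<in> P"
    then have "X ^ N \<in> P" using N by (cases N) (simp_all add: mult_in')
    with XN have "X ^ N - (X ^ N - 1) \<in> P" by (rule diff_in[rotated])
    then show False using one_notin by simp
  qed
  have XiP: "X ^ i \<notin> P" for i
    by (induction i) (use XP one_notin prime_in in auto)
  \<comment> \<open>Since \<open>z ^ d\<close> is an \<open>N\<close>-th root of unity other than 1,
    its first \<open>N\<close> powers sum to 0, so the same sum for \<open>X ^ d\<close> lies in
    \<open>P\<close>. If \<open>X ^ d\<close> were congruent to 1, the sum would be congruent to
    \<open>N\<close>, and \<open>1 = p ^ n - N\<close> would lie in \<open>P\<close>.\<close>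
  have Xd: "X ^ d - 1 \<notin> P" if "0 < d" "d < N" for d
  proof
    assume d: "X ^ d - 1 \<in> P"
    have "(z ^ d - 1) * (\<Sum>j<N. (z ^ d) ^ j) = (z ^ d) ^ N - 1"
      by (simp add: power_diff_1_eq)
    also have "\<dots> = 0" using zN by (metis diff_self mult.commute power_mult power_one)
    finally have "(\<Sum>j<N. (z ^ d) ^ j) = 0" using zd[OF that] by simp
    moreover have "ev (\<Sum>j<k. (X ^ d) ^ j) = (\<Sum>j<k. (z ^ d) ^ j)" for k
      by (induction k) (auto simp: ev_simps evX)
    ultimately have "(\<Sum>j<N. (X ^ d) ^ j) \<in> P" using ker by simp
    moreover have "(\<Sum>j<N. (X ^ d) ^ j - 1 ^ j) \<in> P"
      by (intro sum_in diff_power d)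
    ultimately have "(\<Sum>j<N. (X ^ d) ^ j) - (\<Sum>j<N. (X ^ d) ^ j - 1 ^ j) \<in> P" by (rule diff_in)
    then have "of_nat N \<in> P" by (simp add: sum_subtractf)
    moreover have "of_nat (p ^ n) \<in> P"
      using n pP by (cases n) (simp_all add: mult_in')
    ultimately have "of_nat (p ^ n) - of_nat N \<in> P" by (intro diff_in)
    then show False using one_notin by (simp add: q)
  qed
  have Xij: "X ^ i - X ^ j \<notin> P" if "i < j" "j < N" for i j
  proof
    assume "X ^ i - X ^ j \<in> P"
    moreover have "X ^ i - X ^ j = X ^ i * (1 - X ^ (j - i))"
      using that by (simp add: algebra_simps flip: power_add)
    ultimately have "1 - X ^ (j - i) \<in> P" using prime_in XiP by metis
    moreover have "j - i < N" "0 < j - i" using that by auto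
    ultimately show False using Xd diff_swap by blast
  qed
  have Xij': "X ^ i - X ^ j \<notin> P" if "i \<noteq> j" "i < N" "j < N" for i j
    using Xij[of i j] Xij[of j i] that diff_swap by (metis linorder_neqE_nat)
  define T where "T = insert 0 ((\<lambda>i. X ^ i) ` {..<N})"
  have "inj_on (\<lambda>i. X ^ i) {..<N}"
    using Xij' by (intro inj_onI) (metis diff_self lessThan_iff zero_in)
  moreover have "0 \<notin> (\<lambda>i. X ^ i) ` {..<N}"
    using XiP by (metis imageE zero_in)
  ultimately have "card T = p ^ n"
    by (simp add: T_def card_image q)
  moreover have "finite T" by (simp add: T_def)
  moreover have "s - t \<notin> P" if st: "s \<in> T" "t \<in> T" "s \<noteq> t" for s t
  proof -
    consider i where "s = 0" "t = X ^ i" | i where "s = X ^ i" "t = 0"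
      | i j where "s = X ^ i" "t = X ^ j" "i < N" "j < N"
      using st by (auto simp: T_def)
    then show ?thesis
    proof cases
      case (1 i)
      then show ?thesis using diff_swap[of 0 "X ^ i"] XiP by auto
    next
      case (3 i j)
      then show ?thesis using st(3) Xij'[of i j] by blast
    qed (use XiP in simp)
  qed
  moreover have "t ^ (p ^ n) - t \<in> P" if "t \<in> T" for t
  proof (cases "t = 0")
    case False
    with that obtain i where t: "t = X ^ i" by (auto simp: T_def)
    have "t ^ (p ^ n) - t = t * ((X ^ N) ^ i - 1 ^ i)"
      by (simp add: t q algebra_simps flip: power_mult)
    also have "\<dots> \<in> P" by (intro mult_in diff_power XN)
    finally show ?thesis .
  qed (simp add: q)
  ultimately show thesis using that P pP by blast
qed

section \<open>Maximum distance separable codes\<close>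

text \<open>
  The \<open>q ^ (r + 1)\<close> words \<open>f s c\<close> of length \<open>k\<close> over \<open>{..<q}\<close> pairwise agree in at most \<open>r\<close>
  places, and for every \<open>s\<close> the words \<open>f s c\<close> partition \<open>{..<k} \<times> {..<q}\<close>.
\<close>

definition resolvable_mds_code ::
    "nat \<Rightarrow> nat \<Rightarrow> nat \<Rightarrow> (nat \<Rightarrow> nat \<Rightarrow> nat \<Rightarrow> nat) \<Rightarrow> bool" where
  "resolvable_mds_code q k r f \<longleftrightarrow>
     (\<forall>s<q ^ r. \<forall>c<q. \<forall>a<k. f s c a < q) \<and>
     (\<forall>s<q ^ r. \<forall>a<k. inj_on (\<lambda>c. f s c a) {..<q}) \<and>
     (\<forall>s<q ^ r. \<forall>c<q. \<forall>s'<q ^ r. \<forall>c'<q.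
        (s, c) \<noteq> (s', c') \<longrightarrow> card {a. a < k \<and> f s c a = f s' c' a} \<le> r)"

text \<open>Base \<open>q\<close> digits let the single index \<open>s\<close> of a class carry the
  \<open>r\<close> nonconstant coefficients of a polynomial.\<close>

lemma eq_if_digits_eq:
  fixes q :: nat
  assumes "s < q ^ r" "s' < q ^ r" "\<And>j. j < r \<Longrightarrow> s div q ^ j mod q = s' div q ^ j mod q"
  shows "s = s'"
  using assms
proof (induction r arbitrary: s s')
  case (Suc r)
  have "s div q = s' div q"
  proof (rule Suc.IH)
    show "s div q < q ^ r" "s' div q < q ^ r"
      using Suc.prems(1,2) by (auto simp: less_mult_imp_div_less mult.commute)
    show "s div q div q ^ j mod q = s' div q div q ^ j mod q" if "j < r" for j
      using Suc.prems(3)[of "Suc j"] that by (simp add: div_mult2_eq)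
  qed
  moreover have "s mod q = s' mod q" using Suc.prems(3)[of 0] by simp
  ultimately show ?case by (metis div_mult_mod_eq)
qed simp

text \<open>A word lists the values of a polynomial at \<open>k\<close> elements of
  \<open>T\<close>, distinct because \<open>k \<le> p ^ n\<close>. The constant term comes from
  \<open>c\<close>, so changing \<open>c\<close> alone changes every value; the other coefficients
  come from \<open>s\<close>.\<close>

lemma (in prime_ideal) reed_solomon_code:
  assumes p: "prime p" "of_nat p \<in> P"
    and T: "finite T" "card T = p ^ n"
    and incong: "\<And>s t. s \<in> T \<Longrightarrow> t \<in> T \<Longrightarrow> s \<noteq> t \<Longrightarrow> s - t \<notin> P"
    and fixed: "\<And>t. t \<in> T \<Longrightarrow> t ^ (p ^ n) - t \<in> P"
    and n: "n > 0" and k: "k \<le> p ^ n"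
  shows "\<exists>f. resolvable_mds_code (p ^ n) k r f"
proof -
  define q where "q = p ^ n"
  have q1: "q > 1"
    using one_less_power[OF prime_gt_1_nat[OF p(1)] n] by (simp add: q_def)
  obtain e where e: "bij_betw e {..<q} T"
    using ex_bij_betw_nat_finite[OF T(1)] T(2) by (auto simp: q_def atLeast0LessThan)
  have eT: "e v \<in> T" if "v < q" for v using e that by (auto simp: bij_betw_def)
  have e_inj: "v = w" if "v < q" "w < q" "e v - e w \<in> P" for v w
    using e that incong eT by (metis bij_betw_def inj_onD lessThan_iff)
  \<comment> \<open>Otherwise \<open>T\<close> together with \<open>y\<close> would give
    \<open>q + 1\<close> incongruent roots of \<open>Y ^ q - Y\<close>, forcing its leading
    coefficient 1 into \<open>P\<close>.\<close>
  have rep: "\<exists>v<q. y - e v \<in> P" if y: "y ^ q - y \<in> P" for y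
  proof (rule ccontr)
    assume "\<not> (\<exists>v<q. y - e v \<in> P)"
    then have y': "y - t \<notin> P" if "t \<in> T" for t
      using e that by (metis bij_betw_def imageE lessThan_iff)
    then have yT: "y \<notin> T" by (metis diff_self zero_in)
    define f where "f = monom (1::'a) q - [:0, 1:]"
    have "coeff f q \<in> P"
    proof (rule coeff_in_of_many_roots[of f q "insert y T"])
      show "degree f \<le> q"
        unfolding f_def using q1 by (intro degree_diff_le degree_monom_le) auto
      show "finite (insert y T)" using T by simp
      show "q < card (insert y T)" using T yT by (simp add: q_def)
      show "poly f s \<in> P" if "s \<in> insert y T" for s
        using that y fixed by (auto simp: f_def poly_monom q_def)
      show "s - t \<notin> P" if "s \<in> insert y T" "t \<in> insert y T" "s \<noteq> t" for s t
        using that incong y' diff_swap by blast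
    qed
    moreover have "coeff f q = 1"
      using q1 by (auto simp: f_def coeff_pCons split: nat.split)
    ultimately show False using one_notin by simp
  qed
  define w where "w = (\<lambda>s c. pCons (e c) (Poly (map (\<lambda>j. e (s div q ^ j mod q)) [0..<r])))"
  have w0: "coeff (w s c) 0 = e c" for s c
    by (simp add: w_def)
  have wS: "coeff (w s c) (Suc j) = (if j < r then e (s div q ^ j mod q) else 0)" for s c j
    by (simp add: w_def coeff_Poly_eq nth_default_def)
  have dig: "s div q ^ j mod q < q" for s j using q1 by simp
  \<comment> \<open>The letter is the index of the element of \<open>T\<close> congruent to the
    value. It exists by \<open>rep\<close>, as the coefficients and the point, and hence the value,
    are fixed by the \<open>q\<close>-th power modulo \<open>P\<close>.\<close>
  define f where "f = (\<lambda>s c a. SOME v. v < q \<and> poly (w s c) (e a) - e v \<in> P)"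
  have f: "f s c a < q \<and> poly (w s c) (e a) - e (f s c a) \<in> P" if "c < q" "a < k" for s c a
  proof -
    have "coeff (w s c) i ^ q - coeff (w s c) i \<in> P" for i
      using fixed[OF eT] that(1) dig prime_gt_0_nat[OF p(1)]
      by (cases i) (auto simp: w0 wS q_def power_0_left)
    then have "poly (w s c) (e a) ^ q - poly (w s c) (e a) \<in> P"
      unfolding q_def using p fixed[OF eT[of a]] that(2) k
      by (intro poly_frobenius_fixed) (auto simp: q_def)
    from rep[OF this] show ?thesis
      unfolding f_def by (rule someI_ex)
  qed
  have agree: "poly (w s c - w s' c') (e a) \<in> P"
    if "c < q" "c' < q" "a < k" "f s c a = f s' c' a" for s c s' c' a
    using diff_in f[OF that(1,3)] f[OF that(2,3), of s'] that(4)
    by (metis diff_swap diff_trans poly_diff)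
  have "inj_on (\<lambda>c. f s c a) {..<q}" if "a < k" for s a
  proof (rule inj_onI)
    fix c c' assume c: "c \<in> {..<q}" "c' \<in> {..<q}" and eq: "f s c a = f s c' a"
    have "poly (w s c - w s c') (e a) = e c - e c'"
      by (simp add: w_def)
    then have "e c - e c' \<in> P" using agree[of c c' a s s] c eq that by auto
    then show "c = c'" using c e_inj by auto
  qed
  moreover have "card {a. a < k \<and> f s c a = f s' c' a} \<le> r"
    if s: "s < q ^ r" "s' < q ^ r" and c: "c < q" "c' < q" and ne: "(s, c) \<noteq> (s', c')" for s c s' c'
  proof (rule ccontr)
    let ?A = "{a. a < k \<and> f s c a = f s' c' a}"
    assume "\<not> card ?A \<le> r"
    have aq: "a < q" if "a \<in> ?A" for a using that k by (auto simp: q_def)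
    then have "?A \<subseteq> {..<q}" by blast
    then have inj: "inj_on e ?A"
      using e inj_on_subset unfolding bij_betw_def by blast
    \<comment> \<open>More than \<open>r\<close> agreements are more than \<open>r\<close>
      incongruent roots of a difference of degree at most \<open>r\<close>. Congruent coefficients
      taken from \<open>T\<close> are equal, so both words have the same \<open>c\<close> and the
      same digits of \<open>s\<close>.\<close>
    have co: "coeff (w s c - w s' c') i \<in> P" for i
    proof (rule coeff_in_of_many_roots[of _ r "e ` ?A"])
      show "degree (w s c - w s' c') \<le> r"
      proof (rule degree_le, intro allI impI)
        show "coeff (w s c - w s' c') i = 0" if "r < i" for i
          using that by (cases i) (auto simp: wS)
      qed
      show "finite (e ` ?A)" by simp
      show "r < card (e ` ?A)" using \<open>\<not> card ?A \<le> r\<close> card_image[OF inj] by simp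
      show "poly (w s c - w s' c') x \<in> P" if "x \<in> e ` ?A" for x
        using that agree[OF c] by blast
      show "x - y \<notin> P" if "x \<in> e ` ?A" "y \<in> e ` ?A" "x \<noteq> y" for x y
        using that incong eT aq by blast
    qed
    have "c = c'" using co[of 0] e_inj[OF c] by (simp add: w0)
    moreover have "s = s'"
    proof (rule eq_if_digits_eq[OF s])
      fix j assume "j < r"
      then show "s div q ^ j mod q = s' div q ^ j mod q"
        using co[of "Suc j"] e_inj[OF dig dig] by (simp add: wS)
    qed
    ultimately show False using ne by simp
  qed
  ultimately have "resolvable_mds_code q k r f"
    unfolding resolvable_mds_code_def using f by blast
  then show ?thesis unfolding q_def by blast
qed

lemma resolvable_mds_code_primepow:
  assumes "primepow q" "k \<le> q"
  shows "\<exists>f. resolvable_mds_code q k r f"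
proof -
  from assms(1) obtain p n where pn: "prime p" "n > 0" "q = p ^ n"
    by (auto simp: primepow_def)
  obtain P :: "int poly set" and T where
    PT: "prime_ideal P" "of_nat p \<in> P" "finite T" "card T = p ^ n"
    "\<And>s t. s \<in> T \<Longrightarrow> t \<in> T \<Longrightarrow> s \<noteq> t \<Longrightarrow> s - t \<notin> P"
    "\<And>t. t \<in> T \<Longrightarrow> t ^ (p ^ n) - t \<in> P"
    using exists_prime_ideal_with_residue_field[OF pn(1,2)] by metis
  show ?thesis
    using prime_ideal.reed_solomon_code[OF PT(1) pn(1) PT(2-4) PT(5) PT(6) pn(2)] assms(2)
    unfolding pn(3) by blast
qed

text \<open>Quotient and remainder encode pairs of letters and pairs of indices. Two distinct words
  differ in the index of at least one factor, and agreement in the product implies agreement in that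
  factor.\<close>

lemma resolvable_mds_code_mult:
  assumes f: "resolvable_mds_code q k r f" and g: "resolvable_mds_code q' k r g"
  shows "\<exists>h. resolvable_mds_code (q * q') k r h"
proof -
  define h where "h = (\<lambda>s c a. f (s div q' ^ r) (c div q') a * q' + g (s mod q' ^ r) (c mod q') a)"
  have s_lt: "s div q' ^ r < q ^ r" "s mod q' ^ r < q' ^ r" if "s < (q * q') ^ r" for s
    using that by (auto simp: power_mult_distrib less_mult_imp_div_less intro!: mod_less_divisor gr0I)
  have c_lt: "c div q' < q" "c mod q' < q'" if "c < q * q'" for c
    using that by (auto simp: less_mult_imp_div_less intro!: mod_less_divisor gr0I)
  have g_lt: "g (s mod q' ^ r) (c mod q') a < q'" if "s < (q * q') ^ r" "c < q * q'" "a < k" for s c a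
    using g s_lt(2)[OF that(1)] c_lt(2)[OF that(2)] that(3)
    by (auto simp: resolvable_mds_code_def)
  have h_eqD: "f (s div q' ^ r) (c div q') a = f (s' div q' ^ r) (c' div q') a \<and>
      g (s mod q' ^ r) (c mod q') a = g (s' mod q' ^ r) (c' mod q') a"
    if "s < (q * q') ^ r" "c < q * q'" "s' < (q * q') ^ r" "c' < q * q'" "a < k"
      "h s c a = h s' c' a" for s c s' c' a
  proof -
    \<comment> \<open>Because the letter of \<open>g\<close> is below \<open>q'\<close>, quotient
      and remainder by \<open>q'\<close> recover the letters of \<open>f\<close> and
      \<open>g\<close>.\<close>
    have "h s c a div q' = h s' c' a div q'" "h s c a mod q' = h s' c' a mod q'"
      using that(6) by auto
    then show ?thesis
      using g_lt[OF that(1,2,5)] g_lt[OF that(3,4,5)] by (simp add: h_def)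
  qed
  have "h s c a < q * q'" if "s < (q * q') ^ r" "c < q * q'" "a < k" for s c a
  proof -
    have "f (s div q' ^ r) (c div q') a < q"
      using f s_lt(1)[OF that(1)] c_lt(1)[OF that(2)] that(3)
      by (auto simp: resolvable_mds_code_def)
    then have "Suc (f (s div q' ^ r) (c div q') a) * q' \<le> q * q'"
      by (intro mult_le_mono1) simp
    then show ?thesis using g_lt[OF that] unfolding h_def by simp
  qed
  moreover have "inj_on (\<lambda>c. h s c a) {..<q * q'}" if s: "s < (q * q') ^ r" and a: "a < k" for s a
  proof (rule inj_onI)
    fix c c' assume "c \<in> {..<q * q'}" "c' \<in> {..<q * q'}" and eq: "h s c a = h s c' a"
    then have c: "c < q * q'" "c' < q * q'" by auto
    note D = h_eqD[OF s c(1) s c(2) a eq]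
    have "inj_on (\<lambda>c. f (s div q' ^ r) c a) {..<q}" "inj_on (\<lambda>c. g (s mod q' ^ r) c a) {..<q'}"
      using f g s_lt[OF s] a by (auto simp: resolvable_mds_code_def)
    then have "c div q' = c' div q'" "c mod q' = c' mod q'"
      using D c_lt[OF c(1)] c_lt[OF c(2)] by (auto dest: inj_onD)
    then show "c = c'" by (metis div_mult_mod_eq)
  qed
  moreover have "card {a. a < k \<and> h s c a = h s' c' a} \<le> r"
    if s: "s < (q * q') ^ r" "s' < (q * q') ^ r" and c: "c < q * q'" "c' < q * q'"
      and ne: "(s, c) \<noteq> (s', c')" for s c s' c'
  proof -
    let ?A = "{a. a < k \<and> h s c a = h s' c' a}"
    let ?F = "{a. a < k \<and> f (s div q' ^ r) (c div q') a = f (s' div q' ^ r) (c' div q') a}"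
    let ?G = "{a. a < k \<and> g (s mod q' ^ r) (c mod q') a = g (s' mod q' ^ r) (c' mod q') a}"
    have sub: "?A \<subseteq> ?F" "?A \<subseteq> ?G"
      using h_eqD[OF s(1) c(1) s(2) c(2)] by blast+
    then have le: "card ?A \<le> card ?F" "card ?A \<le> card ?G"
      by (auto intro!: card_mono)
    have "(s div q' ^ r, c div q') \<noteq> (s' div q' ^ r, c' div q') \<or>
        (s mod q' ^ r, c mod q') \<noteq> (s' mod q' ^ r, c' mod q')"
      using ne by (metis div_mult_mod_eq prod.inject)
    then show ?thesis
    proof
      assume "(s div q' ^ r, c div q') \<noteq> (s' div q' ^ r, c' div q')"
      then have "card ?F \<le> r"
        using f s_lt(1)[OF s(1)] s_lt(1)[OF s(2)] c_lt(1)[OF c(1)] c_lt(1)[OF c(2)]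
        unfolding resolvable_mds_code_def by blast
      with le show ?thesis by simp
    next
      assume "(s mod q' ^ r, c mod q') \<noteq> (s' mod q' ^ r, c' mod q')"
      then have "card ?G \<le> r"
        using g s_lt(2)[OF s(1)] s_lt(2)[OF s(2)] c_lt(2)[OF c(1)] c_lt(2)[OF c(2)]
        unfolding resolvable_mds_code_def by blast
      with le show ?thesis by simp
    qed
  qed
  ultimately have "resolvable_mds_code (q * q') k r h"
    unfolding resolvable_mds_code_def by blast
  then show ?thesis by blast
qed

lemma resolvable_mds_code_prod:
  assumes "finite I" "\<And>i. i \<in> I \<Longrightarrow> primepow (p i)" "\<And>i. i \<in> I \<Longrightarrow> k \<le> p i"
  shows "\<exists>f. resolvable_mds_code (\<Prod>i\<in>I. p i) k r f"
  using assms
proof (induction I rule: finite_induct)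
  case empty
  \<comment> \<open>Over one letter there is only the index pair \<open>(0, 0)\<close>, so the
    agreement condition is vacuous.\<close>
  have "resolvable_mds_code 1 k r (\<lambda>_ _ _. 0)"
    by (auto simp: resolvable_mds_code_def inj_on_def)
  then show ?case by auto
next
  case (insert i I)
  obtain f where "resolvable_mds_code (p i) k r f"
    using resolvable_mds_code_primepow[of "p i" k r] insert.prems by auto
  moreover obtain g where "resolvable_mds_code (\<Prod>i\<in>I. p i) k r g"
    using insert.IH insert.prems by auto
  ultimately show ?case
    using resolvable_mds_code_mult insert.hyps by simp
qed

section \<open>Bases supported on the blocks of a code\<close>

definition fourier :: "nat \<Rightarrow> nat \<Rightarrow> nat \<Rightarrow> complex" where
  "fourier k a b = cis (2 * pi * real b / real k) ^ a / of_real (sqrt (real k))"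

lemma norm_fourier: "cmod (fourier k a b) = 1 / sqrt (real k)"
  by (simp add: fourier_def norm_divide norm_power)

text \<open>For \<open>b \<noteq> b'\<close> the sum is a multiple of a geometric sum over a
  \<open>k\<close>-th root of unity other than 1, which vanishes.\<close>

lemma fourier_orthogonal:
  assumes "b < k" "b' < k"
  shows "(\<Sum>a<k. fourier k a b * cnj (fourier k a b')) = (if b = b' then 1 else 0)"
proof -
  have k: "k > 0" using assms by simp
  define u where "u = (\<lambda>b. cis (2 * pi * real b / real k))"
  define z where "z = u b * cnj (u b')"
  have u_unit: "u c * cnj (u c) = 1" for c
    by (simp add: u_def complex_norm_square[symmetric])
  have "of_real (sqrt (real k)) * of_real (sqrt (real k)) = (of_nat k :: complex)"
    by (simp flip: of_real_mult)
  then have "fourier k a b * cnj (fourier k a b') = z ^ a / of_nat k" for a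
    by (simp add: fourier_def z_def u_def power_mult_distrib)
  then have eq: "(\<Sum>a<k. fourier k a b * cnj (fourier k a b')) = (\<Sum>a<k. z ^ a) / of_nat k"
    by (simp add: sum_divide_distrib)
  show ?thesis
  proof (cases "b = b'")
    case True
    then have "z = 1" using u_unit by (simp add: z_def)
    then show ?thesis using eq True k by simp
  next
    case False
    have "u c ^ k = 1" for c
      using k by (simp add: u_def DeMoivre)
    then have "u b ^ k = 1" "cnj (u b' ^ k) = 1" by auto
    then have "z ^ k = 1"
      by (simp add: z_def power_mult_distrib)
    moreover have "z \<noteq> 1"
    proof
      assume "z = 1"
      have "u b * (u b' * cnj (u b')) = z * u b'" by (simp only: z_def ac_simps)
      then have "u b = u b'" by (simp only: u_unit \<open>z = 1\<close> mult_1 mult_1_right)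
      moreover have "inj_on u {..<k}"
        using bij_betw_roots_unity[OF k] by (simp add: bij_betw_def u_def)
      ultimately show False using assms False by (simp add: inj_on_eq_iff)
    qed
    moreover have "(z - 1) * (\<Sum>a<k. z ^ a) = z ^ k - 1"
      by (simp add: power_diff_1_eq)
    ultimately show ?thesis using eq False by simp
  qed
qed

text \<open>This turns a sum over matrix rows into one over points of the grid, grouped by the
  coordinate \<open>a\<close>.\<close>

lemma sum_div_mod:
  fixes g :: "nat \<Rightarrow> nat \<Rightarrow> 'a::comm_monoid_add"
  shows "(\<Sum>i<m * k. g (i div k) (i mod k)) = (\<Sum>a<k. \<Sum>x<m. g x a)"
proof -
  have "(\<Sum>i<m * k. g (i div k) (i mod k)) = (\<Sum>(x, a)\<in>{..<m} \<times> {..<k}. g x a)"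
  proof (rule sum.reindex_bij_witness[of _ "\<lambda>(x, a). x * k + a" "\<lambda>i. (i div k, i mod k)"])
    fix y assume "y \<in> {..<m} \<times> {..<k}"
    then obtain x a where y: "y = (x, a)" "x < m" "a < k" by auto
    then have "x * k + a < Suc x * k" by simp
    also have "\<dots> \<le> m * k" using y by (intro mult_le_mono1) simp
    finally show "(case y of (x, a) \<Rightarrow> x * k + a) \<in> {..<m * k}" using y by simp
  qed (auto simp: less_mult_imp_div_less intro!: mod_less_divisor gr0I)
  also have "\<dots> = (\<Sum>x<m. \<Sum>a<k. g x a)" by (rule sum.cartesian_product[symmetric])
  also have "\<dots> = (\<Sum>a<k. \<Sum>x<m. g x a)" by (rule sum.swap)
  finally show ?thesis .
qed

text \<open>This matches the concatenated column lists of the bases with the \<open>div\<close> and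
  \<open>mod\<close> indexing of \<open>frame\<close>.\<close>

lemma concat_map_upt_blocks:
  "concat (map (\<lambda>s. map (h s) [0..<n]) [0..<q]) = map (\<lambda>j. h (j div n) (j mod n)) [0..<n * q]"
proof (induction q)
  case (Suc q)
  have "[0..<n * Suc q] = [0..<n * q + n]" by (simp add: add.commute)
  also have "\<dots> = [0..<n * q] @ [n * q..<n * q + n]" by (rule upt_add_eq_append) simp
  also have "[n * q..<n * q + n] = map (\<lambda>j. j + n * q) [0..<n]"
    by (simp add: map_add_upt add.commute)
  finally have "[0..<n * Suc q] = [0..<n * q] @ map (\<lambda>j. j + n * q) [0..<n]" .
  moreover have "map (\<lambda>j. h ((j + n * q) div n) ((j + n * q) mod n)) [0..<n] = map (h q) [0..<n]"
    by (rule map_cong) auto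
  ultimately show ?case using Suc by (simp add: comp_def)
qed simp

lemma mat_adjoint_carrier: "A \<in> carrier_mat n n \<Longrightarrow> mat_adjoint A \<in> carrier_mat n n"
  by (auto simp: mat_adjoint_def mat_of_rows_def)

section \<open>Inner products, coherence and density of the frame of a code\<close>

locale code_frame =
  fixes m r k :: nat and f :: "nat \<Rightarrow> nat \<Rightarrow> nat \<Rightarrow> nat"
  assumes m: "m > 0" and r: "0 < r" and rk: "r < k"
    and code: "resolvable_mds_code m k r f"
begin

text \<open>
  Row \<open>x * k + a\<close> stands for the point \<open>(a, x)\<close>; column \<open>c * k + b\<close> of the basis \<open>s\<close> is the
  \<open>b\<close>-th Fourier vector placed on the graph of the word \<open>f s c\<close>.
\<close>

definition entry :: "nat \<Rightarrow> nat \<Rightarrow> nat \<Rightarrow> complex" where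
  "entry s l i = (if i div k = f s (l div k) (i mod k) then fourier k (i mod k) (l mod k) else 0)"

definition basis :: "nat \<Rightarrow> complex mat" where
  "basis s = mat (m * k) (m * k) (\<lambda>(i, l). entry s l i)"

definition frame :: "complex mat" where
  "frame = mat (m * k) (m * k * m ^ r) (\<lambda>(i, j). entry (j div (m * k)) (j mod (m * k)) i)"

definition ip :: "nat \<Rightarrow> nat \<Rightarrow> nat \<Rightarrow> nat \<Rightarrow> complex" where
  "ip s l s' l' = (\<Sum>i<m * k. entry s l i * cnj (entry s' l' i))"

lemma k: "k > 0" using rk by simp

lemma f_less: "s < m ^ r \<Longrightarrow> l < m * k \<Longrightarrow> a < k \<Longrightarrow> f s (l div k) a < m"
  using code less_mult_imp_div_less by (auto simp: resolvable_mds_code_def)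

text \<open>Each graph has exactly one point over every coordinate \<open>a\<close>, so only the
  coordinates where the two words agree contribute.\<close>

lemma ip_eq:
  assumes "s < m ^ r" "l < m * k"
  shows "ip s l s' l' = (\<Sum>a<k. if f s (l div k) a = f s' (l' div k) a
           then fourier k a (l mod k) * cnj (fourier k a (l' mod k)) else 0)"
proof -
  have "ip s l s' l' = (\<Sum>a<k. \<Sum>x<m.
      (if x = f s (l div k) a then fourier k a (l mod k) else 0)
      * cnj (if x = f s' (l' div k) a then fourier k a (l' mod k) else 0))"
    unfolding ip_def entry_def by (rule sum_div_mod)
  also have "\<dots> = (\<Sum>a<k. \<Sum>x<m. if x = f s (l div k) a then
      (if f s (l div k) a = f s' (l' div k) a
       then fourier k a (l mod k) * cnj (fourier k a (l' mod k)) else 0) else 0)"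
    by (intro sum.cong) auto
  also have "\<dots> = (\<Sum>a<k. if f s (l div k) a = f s' (l' div k) a
           then fourier k a (l mod k) * cnj (fourier k a (l' mod k)) else 0)"
    using f_less[OF assms] by (intro sum.cong) auto
  finally show ?thesis .
qed

text \<open>Columns on the same graph are orthonormal by the Fourier relations; columns on different
  graphs of one class have disjoint supports.\<close>

lemma ip_same_basis:
  assumes s: "s < m ^ r" and l: "l < m * k" "l' < m * k"
  shows "ip s l s l' = (if l = l' then 1 else 0)"
proof (cases "l div k = l' div k")
  case True
  then have "l = l' \<longleftrightarrow> l mod k = l' mod k" by (metis div_mult_mod_eq)
  then show ?thesis
    using True k by (simp add: ip_eq[OF s l(1)] fourier_orthogonal)
next
  case False
  have "f s (l div k) a \<noteq> f s (l' div k) a" if "a < k" for a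
  proof -
    have "inj_on (\<lambda>c. f s c a) {..<m}"
      using code s that by (auto simp: resolvable_mds_code_def)
    then show ?thesis using False l less_mult_imp_div_less by (auto dest: inj_onD)
  qed
  then show ?thesis using False by (auto simp: ip_eq[OF s l(1)])
qed

lemma norm_ip_le:
  assumes s: "s < m ^ r" "s' < m ^ r" and l: "l < m * k" "l' < m * k" and ne: "s \<noteq> s'"
  shows "cmod (ip s l s' l') \<le> real r / real k"
proof -
  let ?A = "{a. a < k \<and> f s (l div k) a = f s' (l' div k) a}"
  have "cmod (ip s l s' l') \<le> (\<Sum>a<k. if a \<in> ?A then 1 / real k else 0)"
    unfolding ip_eq[OF s(1) l(1)]
    by (intro sum_norm_le) (auto simp: norm_mult norm_fourier)
  also have "\<dots> = (\<Sum>a\<in>{..<k} \<inter> ?A. 1 / real k)"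
    by (rule sum.inter_restrict[symmetric]) simp
  also have "{..<k} \<inter> ?A = ?A" by auto
  also have "(\<Sum>a\<in>?A. 1 / real k) = real (card ?A) / real k" by simp
  also have "card ?A \<le> r"
    using code[unfolded resolvable_mds_code_def, THEN conjunct2, THEN conjunct2, rule_format,
        OF s(1) less_mult_imp_div_less[OF l(1)] s(2) less_mult_imp_div_less[OF l(2)]] ne
    by simp
  finally show ?thesis by (simp add: divide_right_mono)
qed

lemma col_div_mod:
  assumes "j < m * k * m ^ r"
  shows "j div (m * k) < m ^ r" "j mod (m * k) < m * k"
  using assms m k by (auto simp: less_mult_imp_div_less mult.commute)

lemma unitary_basis:
  assumes s: "s < m ^ r"
  shows "unitary_mat (basis s)"
proof -
  have B: "basis s \<in> carrier_mat (m * k) (m * k)" by (simp add: basis_def)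
  have C: "mat_adjoint (basis s) \<in> carrier_mat (m * k) (m * k)"
    using B by (rule mat_adjoint_carrier)
  \<comment> \<open>Orthonormality of the columns gives a left inverse, which for a square matrix is
    two-sided.\<close>
  have "mat_adjoint (basis s) * basis s = 1\<^sub>m (m * k)"
  proof (rule eq_matI)
    fix i j assume "i < dim_row (1\<^sub>m (m * k))" "j < dim_col (1\<^sub>m (m * k))"
    then have ij: "i < m * k" "j < m * k" by auto
    have "(mat_adjoint (basis s) * basis s) $$ (i, j) = conjugate (col (basis s) i) \<bullet> col (basis s) j"
      using B C ij by (simp add: mat_adjoint_def)
    also have "\<dots> = ip s j s i"
      using ij by (simp add: basis_def scalar_prod_def ip_def atLeast0LessThan mult.commute)
    also have "\<dots> = 1\<^sub>m (m * k) $$ (i, j)"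
      using ij by (simp add: ip_same_basis[OF s] eq_commute)
    finally show "(mat_adjoint (basis s) * basis s) $$ (i, j) = 1\<^sub>m (m * k) $$ (i, j)" .
  qed (use B C in auto)
  then show ?thesis
    using mat_mult_left_right_inverse[OF C B] B C
    by (auto simp: unitary_mat_def inverts_mat_def)
qed

lemma frame_union: "union_of_orthonormal_bases (m * k) (m ^ r) frame"
  unfolding union_of_orthonormal_bases_def
proof (intro conjI exI[of _ "map basis [0..<m ^ r]"])
  show "frame \<in> carrier_mat (m * k) (m * k * m ^ r)" by (simp add: frame_def)
  show "\<forall>V\<in>set (map basis [0..<m ^ r]). V \<in> carrier_mat (m * k) (m * k) \<and> unitary_mat V"
    using unitary_basis by (auto simp: basis_def)
  have "concat (map cols (map basis [0..<m ^ r]))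
      = concat (map (\<lambda>s. map (\<lambda>l. vec (m * k) (entry s l)) [0..<m * k]) [0..<m ^ r])"
    by (intro arg_cong[where f = concat])
      (auto simp: cols_def basis_def intro!: eq_vecI)
  also have "\<dots> = map (\<lambda>j. vec (m * k) (entry (j div (m * k)) (j mod (m * k)))) [0..<m * k * m ^ r]"
    by (rule concat_map_upt_blocks)
  also have "\<dots> = cols frame"
    by (auto simp: cols_def frame_def intro!: eq_vecI)
  finally show "frame = mat_of_cols (m * k) (concat (map cols (map basis [0..<m ^ r])))"
    using mat_of_cols_cols[of frame] by (simp add: frame_def)
qed simp

lemma frame_inner:
  assumes "j < m * k * m ^ r" "j' < m * k * m ^ r"
  shows "col frame j \<bullet>c col frame j'
    = ip (j div (m * k)) (j mod (m * k)) (j' div (m * k)) (j' mod (m * k))"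
  using assms by (simp add: frame_def scalar_prod_def ip_def atLeast0LessThan)

lemma frame_norm:
  assumes j: "j < m * k * m ^ r"
  shows "l2_norm_vec (col frame j) = 1"
proof -
  let ?e = "entry (j div (m * k)) (j mod (m * k))"
  have "l2_norm_vec (col frame j) = sqrt (\<Sum>i<m * k. (cmod (?e i))\<^sup>2)"
    using j by (simp add: l2_norm_vec_def L2_set_def frame_def)
  moreover have "of_real (\<Sum>i<m * k. (cmod (?e i))\<^sup>2) = (1 :: complex)"
    using ip_same_basis[OF col_div_mod(1)[OF j] col_div_mod(2)[OF j] col_div_mod(2)[OF j]]
    by (simp add: ip_def complex_norm_square del: of_real_power)
  ultimately show ?thesis by (metis of_real_eq_1_iff real_sqrt_one)
qed

lemma frame_coherence: "coherence frame \<le> real r / real k"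
proof -
  have dim: "dim_col frame = m * k * m ^ r" by (simp add: frame_def)
  let ?h = "\<lambda>i j. cmod (col frame i \<bullet>c col frame j) / (l2_norm_vec (col frame i) * l2_norm_vec (col frame j))"
  let ?S = "{?h i j | i j. i < dim_col frame \<and> j < dim_col frame \<and> i \<noteq> j}"
  have "?S \<subseteq> (\<lambda>(i, j). ?h i j) ` ({..<dim_col frame} \<times> {..<dim_col frame})" by auto
  then have fin: "finite ?S" by (rule finite_subset) simp
  \<comment> \<open>A pair of distinct columns must exist, so that the maximum in
    \<open>coherence\<close> is over a nonempty set; \<open>0 < r < k\<close> gives
    \<open>k \<ge> 2\<close>.\<close>
  have "2 \<le> m * k * m ^ r"
  proof -
    have "1 * k * 1 \<le> m * k * m ^ r" using m by (intro mult_le_mono) auto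
    then have "k \<le> m * k * m ^ r" by (simp only: mult_1 mult_1_right)
    then show ?thesis using r rk by linarith
  qed
  then have "0 < dim_col frame \<and> 1 < dim_col frame \<and> (0::nat) \<noteq> 1" using m k by (simp add: dim)
  then have ne: "?S \<noteq> {}" by blast
  have "x \<le> real r / real k" if "x \<in> ?S" for x
  proof -
    from that obtain i j where x: "x = ?h i j" and ij: "i < m * k * m ^ r" "j < m * k * m ^ r" "i \<noteq> j"
      by (auto simp: dim)
    have x: "x = cmod (ip (i div (m * k)) (i mod (m * k)) (j div (m * k)) (j mod (m * k)))"
      using x ij by (simp add: frame_norm frame_inner)
    show ?thesis
    proof (cases "i div (m * k) = j div (m * k)")
      case True
      then have "i mod (m * k) \<noteq> j mod (m * k)" using ij(3) by (metis div_mult_mod_eq)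
      then have "x = 0"
        unfolding x True using col_div_mod ij(1,2) by (simp add: ip_same_basis)
      then show ?thesis by simp
    next
      case False
      then show ?thesis unfolding x using col_div_mod ij(1,2) by (intro norm_ip_le) auto
    qed
  qed
  then show ?thesis unfolding coherence_def using Max_le_iff[OF fin ne] by blast
qed

lemma frame_density: "density frame = 1 / real m"
proof -
  let ?N = "m * k * m ^ r"
  let ?Z = "{(i, j). i < dim_row frame \<and> j < dim_col frame \<and> frame $$ (i, j) \<noteq> 0}"
  define F where "F = (\<lambda>j. f (j div (m * k)) (j mod (m * k) div k))"
  \<comment> \<open>\<open>\<phi>\<close> enumerates the nonzero positions: column \<open>j\<close>
    has one for every coordinate \<open>a < k\<close>, hence \<open>k\<close> among its
    \<open>m * k\<close> entries. Reducing the row index modulo \<open>k\<close> recovers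
    \<open>a\<close>.\<close>
  define \<phi> where "\<phi> = (\<lambda>(a, j). (F j a * k + a, j))"
  have nz: "fourier k a b \<noteq> 0" for a b using k by (simp add: fourier_def)
  have "?Z = \<phi> ` ({..<k} \<times> {..<?N})"
  proof (intro equalityI subsetI)
    fix y assume "y \<in> ?Z"
    then obtain i j where y: "y = (i, j)" "i < m * k" "j < ?N" "frame $$ (i, j) \<noteq> 0"
      by (auto simp: frame_def)
    then have "i div k = F j (i mod k)"
      by (auto simp: frame_def entry_def F_def split: if_splits)
    then have "y = \<phi> (i mod k, j)" using y by (simp add: \<phi>_def) (metis div_mult_mod_eq)
    then show "y \<in> \<phi> ` ({..<k} \<times> {..<?N})" by (rule image_eqI) (use y k in simp)
  next
    fix y assume "y \<in> \<phi> ` ({..<k} \<times> {..<?N})"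
    then obtain a j where y: "y = (F j a * k + a, j)" "a < k" "j < ?N" by (auto simp: \<phi>_def)
    have "F j a < m" unfolding F_def using col_div_mod y(2,3) by (intro f_less) auto
    then have "Suc (F j a) * k \<le> m * k" by (intro mult_le_mono1) simp
    then have "F j a * k + a < m * k" using y(2) by simp
    then show "y \<in> ?Z" using y nz by (auto simp: frame_def entry_def F_def)
  qed
  moreover have "inj_on \<phi> ({..<k} \<times> {..<?N})"
  proof (rule inj_onI)
    fix y y' assume "y \<in> {..<k} \<times> {..<?N}" "y' \<in> {..<k} \<times> {..<?N}" "\<phi> y = \<phi> y'"
    then obtain a a' j where "y = (a, j)" "y' = (a', j)" "a < k" "a' < k"
        and eq: "F j a * k + a = F j a' * k + a'"
      by (auto simp: \<phi>_def)
    moreover have "a mod k = a' mod k"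
      using arg_cong[OF eq, of "\<lambda>x. x mod k"] by simp
    ultimately show "y = y'" by simp
  qed
  ultimately have "card ?Z = k * ?N" by (simp add: card_image)
  moreover have "dim_row frame = m * k" "dim_col frame = ?N" by (auto simp: frame_def)
  ultimately have "density frame = real k * real ?N / (real k * real ?N * real m)"
    by (simp add: density_def ac_simps)
  moreover have "real k * real ?N \<noteq> 0" using m k by simp
  ultimately show ?thesis by simp
qed

end

text \<open>The squared moduli in the first row sum to 1, and each of these \<open>k\<close> terms
  is at most \<open>\<alpha>\<^sup>2\<close>.\<close>

lemma unitary_max_entry:
  assumes U: "U \<in> carrier_mat k k" "unitary_mat U" and k: "k > 0"
    and \<alpha>: "\<alpha> = Max {cmod (U $$ (i, j)) | i j. i < k \<and> j < k}"
  shows "1 / real k \<le> \<alpha>\<^sup>2"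
proof -
  let ?S = "{cmod (U $$ (i, j)) | i j. i < k \<and> j < k}"
  have "?S \<subseteq> (\<lambda>(i, j). cmod (U $$ (i, j))) ` ({..<k} \<times> {..<k})" by auto
  then have "finite ?S" by (rule finite_subset) simp
  then have le: "cmod (U $$ (0, j)) \<le> \<alpha>" if "j < k" for j
    unfolding \<alpha> by (rule Max_ge) (use that k in blast)+
  have "mat_adjoint U * U = 1\<^sub>m k"
    using U by (auto simp: unitary_mat_def inverts_mat_def mat_adjoint_def)
  moreover have "mat_adjoint U \<in> carrier_mat k k"
    using U(1) by (rule mat_adjoint_carrier)
  ultimately have "U * mat_adjoint U = 1\<^sub>m k"
    using mat_mult_left_right_inverse U(1) by blast
  then have "(U * mat_adjoint U) $$ (0, 0) = 1" using k by simp
  moreover have "(U * mat_adjoint U) $$ (0, 0) = (\<Sum>j<k. U $$ (0, j) * cnj (U $$ (0, j)))"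
    using U(1) k by (simp add: mat_adjoint_def scalar_prod_def atLeast0LessThan mat_of_rows_def)
  ultimately have "of_real (\<Sum>j<k. (cmod (U $$ (0, j)))\<^sup>2) = (1 :: complex)"
    by (simp add: complex_norm_square del: of_real_power)
  then have "1 = (\<Sum>j<k. (cmod (U $$ (0, j)))\<^sup>2)" by (metis of_real_eq_1_iff)
  also have "\<dots> \<le> (\<Sum>j<k. \<alpha>\<^sup>2)" using le by (intro sum_mono power_mono) auto
  also have "\<dots> = real k * \<alpha>\<^sup>2" by simp
  finally show ?thesis using k by (simp add: field_simps)
qed

theorem theoremV4:
  fixes t m r k :: nat and p :: "nat \<Rightarrow> nat" and U :: "complex mat" and \<alpha> :: real
  assumes "t \<ge> 1"
    and "\<And>i. i \<in> {1..t} \<Longrightarrow> prime (p i) \<or> primepow (p i)"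
    and "m = (\<Prod>i=1..t. p i)"
    and "0 < r" and "r < k" and "k \<le> Min (p ` {1..t})"
    and "U \<in> carrier_mat k k" and "unitary_mat U"
    and "\<alpha> = Max {cmod (U $$ (i, j)) | i j. i < k \<and> j < k}"
  shows "\<exists>A. A \<in> carrier_mat (m * k) (m * k * m ^ r) \<and>
             union_of_orthonormal_bases (m * k) (m ^ r) A \<and>
             coherence A \<le> min (real r * \<alpha>\<^sup>2) 1 \<and>
             density A = 1 / real m"
proof -
  have k: "k > 0" using assms(5) by simp
  have pp: "primepow (p i)" and kp: "k \<le> p i" if "i \<in> {1..t}" for i
    using assms(2)[OF that] assms(6) that by (auto intro: order.trans[OF _ Min_le])
  then obtain f where f: "resolvable_mds_code m k r f"
    using resolvable_mds_code_prod[of "{1..t}" p k r] assms(3) by auto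
  have m: "m > 0" unfolding assms(3) using kp k by (intro prod_pos) fastforce
  interpret code_frame m r k f
    using m f assms(4,5) by unfold_locales auto
  \<comment> \<open>The Fourier frame has coherence at most \<open>r / k\<close>, and the lower
    bound on the largest entry of \<open>U\<close> brings this below the required value.\<close>
  have "real r / real k \<le> real r * \<alpha>\<^sup>2"
    using mult_left_mono[OF unitary_max_entry[OF assms(7,8) k assms(9)], of "real r"] by simp
  moreover have "real r / real k \<le> 1" using assms(5) by simp
  ultimately have "coherence frame \<le> min (real r * \<alpha>\<^sup>2) 1"
    using frame_coherence by simp
  moreover have "frame \<in> carrier_mat (m * k) (m * k * m ^ r)" by (simp add: frame_def)
  ultimately show ?thesis using frame_union frame_density by blast
qed

end
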